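(* Let $H\in(\frac13,\frac12)$, $T>0$, $\sigma\in\mathbb{R}$ and $X_0\in\mathbb{R}$ (deterministic). Let $B=\{B_t\}_{t\in[0,T]}$ be a scalar fractional Brownian motion with Hurst parameter $H$ on a probability space $(\Omega,\mathcal{F},\mathbb{P})$. Assume that $a(x)=Ax$ for $x\in\mathbb{R}$, with a constant $A\in\mathbb{R}$. Let $X$ be the solution of $$X_t=X_0+\int_0^t a(X_s)\,{\rm d}s+\sigma B_t,\qquad t\in[0,T].$$ For $n\in\mathbb{N}_+$ put $h=\frac Tn$, $t_k=kh$ ($k=0,\dots,n$), and let $Y$ (depending on $n$) be the continuously interpolated Euler scheme defined by $Y_0=X_0$ and $$Y_t=Y_{t_k}+a(Y_{t_k})(t-t_k)+\sigma(B_t-B_{t_k}),\qquad t\in(t_k,t_{k+1}],\ k=0,\dots,n-1.$$ Then there is a constant $C$, independent of $n$ (equivalently of $h$), such that for every $n\in\mathbb{N}_+$ $$\Big(\sup_{t\in[0,T]}\mathbb{E}|X_t-Y_t|^2\Big)^{1/2}\le C h^{H+\frac12}.$$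
   Context: A scalar fractional Brownian motion with Hurst parameter $H\in(0,1)$ is a continuous centered Gaussian process $B=\{B_t\}_{t\in[0,T]}$ with $B_0=0$ almost surely and covariance $\mathbb{E}[B_sB_t]=\frac12\big(t^{2H}+s^{2H}-|t-s|^{2H}\big)$ for $s,t\in[0,T]$. The noise is additive, so the equation ${\rm d}X_t=a(X_t)\,{\rm d}t+\sigma\,{\rm d}B_t$ is understood pathwise as the integral equation in the claim. $C$ denotes a generic constant that may depend on $H,T,\sigma,X_0,A$ but not on $n$. *)

theory Defs
  imports "HOL-Probability.Probability"
begin

text \<open>Point masses count as Gaussian laws (standard deviation \<open>0\<close>); they need a separate case because
  \<^term>\<open>normal_density m 0\<close> is identically zero.\<close>

definition gaussian_law :: "real \<Rightarrow> real \<Rightarrow> real measure" where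
  "gaussian_law m s = (if s = 0 then return borel m else density lborel (normal_density m s))"

definition gaussian_rv :: "'w measure \<Rightarrow> ('w \<Rightarrow> real) \<Rightarrow> bool" where
  "gaussian_rv M Z \<longleftrightarrow> Z \<in> borel_measurable M \<and> (\<exists>m. \<exists>s\<ge>0. distr M borel Z = gaussian_law m s)"

text \<open>Joint Gaussianity of the finite-dimensional distributions, expressed through linear combinations.\<close>

definition gaussian_process :: "'w measure \<Rightarrow> real set \<Rightarrow> (real \<Rightarrow> 'w \<Rightarrow> real) \<Rightarrow> bool" where
  "gaussian_process M I B \<longleftrightarrow>
     (\<forall>F c. finite F \<and> F \<subseteq> I \<longrightarrow> gaussian_rv M (\<lambda>\<omega>. \<Sum>t\<in>F. c t * B t \<omega>))"

definition fractional_brownian_motion ::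
    "'w measure \<Rightarrow> real \<Rightarrow> real \<Rightarrow> (real \<Rightarrow> 'w \<Rightarrow> real) \<Rightarrow> bool" where
  "fractional_brownian_motion M H T B \<longleftrightarrow>
     gaussian_process M {0..T} B \<and>
     (AE \<omega> in M. continuous_on {0..T} (\<lambda>t. B t \<omega>)) \<and>
     (AE \<omega> in M. B 0 \<omega> = 0) \<and>
     (\<forall>t\<in>{0..T}. (LINT \<omega>|M. B t \<omega>) = 0) \<and>
     (\<forall>s\<in>{0..T}. \<forall>t\<in>{0..T}. (LINT \<omega>|M. B s \<omega> * B t \<omega>) =
        (t powr (2 * H) + s powr (2 * H) - \<bar>t - s\<bar> powr (2 * H)) / 2)"

definition additive_sde_solution ::
    "'w measure \<Rightarrow> real \<Rightarrow> (real \<Rightarrow> real) \<Rightarrow> real \<Rightarrow> real \<Rightarrow> (real \<Rightarrow> 'w \<Rightarrow> real) \<Rightarrow> (real \<Rightarrow> 'w \<Rightarrow> real) \<Rightarrow> bool"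
  where
  "additive_sde_solution M T a \<sigma> x0 B X \<longleftrightarrow>
     (\<forall>t\<in>{0..T}. X t \<in> borel_measurable M) \<and>
     (AE \<omega> in M. continuous_on {0..T} (\<lambda>t. X t \<omega>) \<and>
        (\<forall>t\<in>{0..T}. X t \<omega> = x0 + integral {0..t} (\<lambda>s. a (X s \<omega>)) + \<sigma> * B t \<omega>))"

definition euler_scheme ::
    "'w measure \<Rightarrow> real \<Rightarrow> nat \<Rightarrow> (real \<Rightarrow> real) \<Rightarrow> real \<Rightarrow> real \<Rightarrow> (real \<Rightarrow> 'w \<Rightarrow> real) \<Rightarrow> (real \<Rightarrow> 'w \<Rightarrow> real) \<Rightarrow> bool"
  where
  "euler_scheme M T n a \<sigma> x0 B Y \<longleftrightarrow>
     (let h = T / real n; \<tau> = (\<lambda>k. real k * h) in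
       \<forall>\<omega>\<in>space M. Y 0 \<omega> = x0 \<and>
         (\<forall>k<n. \<forall>t\<in>{\<tau> k<..\<tau> (k + 1)}.
            Y t \<omega> = Y (\<tau> k) \<omega> + a (Y (\<tau> k) \<omega>) * (t - \<tau> k) + \<sigma> * (B t \<omega> - B (\<tau> k) \<omega>)))"

end

theory Submission
  imports Defs
begin

text \<open>At the grid points the error \<open>e\<close> satisfies \<open>e (k + 1) = (1 + A h) e k + A r k\<close>, where \<open>r k\<close> is the
  integral of \<open>X s - X (t k)\<close> over the step. The drift part of \<open>r k\<close> contributes only \<open>O(h)\<close> to \<open>e\<close>
  after summation, which suffices because \<open>H + 1/2 \<le> 1\<close>. The noise part contributes weighted sums of increments
  \<open>B (t j + u) - B (t j)\<close> with a common offset \<open>u\<close>, integrated over \<open>u \<in> [0, h]\<close>. Since \<open>H < 1/2\<close>,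
  distinct increments are negatively correlated and, by concavity of \<open>x \<mapsto> x powr (2 H)\<close>, the absolute
  covariances with a fixed increment have a telescoping bound of order \<open>h powr (2 H)\<close>. So
  a sum of at most \<open>T / h\<close> increments has variance \<open>O(h powr (2 H - 1))\<close>, and integrating over an interval
  of length \<open>h\<close> gives the mean square order \<open>h powr (2 H + 1)\<close>.\<close>

subsection \<open>Mean squares of pathwise integrals\<close>

text \<open>By uniform continuity, every cell of width \<open>s < \<delta>\<close> contributes an
  error of at most \<open>s * e\<close>. Each sum uses finitely many values of \<open>f\<close>, so
  along random paths it is measurable in the sample point.\<close>

lemma riemann_sum_tendsto:
  fixes f :: "real \<Rightarrow> real"
  assumes d: "0 \<le> d" and f: "continuous_on {0..d} f"
  shows "(\<lambda>N. d / real (Suc N) * (\<Sum>i<Suc N. f (real i * (d / real (Suc N))))) \<longlonglongrightarrow> integral {0..d} f"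
proof (rule LIMSEQ_I)
  fix r :: real assume r: "0 < r"
  \<comment> \<open>The \<open>d + 1\<close> in the denominator covers \<open>d = 0\<close> and
    keeps the total error \<open>d * e\<close> below \<open>r\<close>.\<close>
  define e where "e = r / (2 * (d + 1))"
  have e: "0 < e" and de: "d * e < r"
    using r d by (auto simp: e_def field_simps add_strict_increasing)
  have "uniformly_continuous_on {0..d} f"
    using f by (intro compact_uniformly_continuous) auto
  then obtain \<delta> where \<delta>: "0 < \<delta>"
    and close: "\<And>x x'. x \<in> {0..d} \<Longrightarrow> x' \<in> {0..d} \<Longrightarrow> dist x' x < \<delta> \<Longrightarrow> dist (f x') (f x) < e"
    using e by (metis uniformly_continuous_onE)
  obtain N0 where N0: "d / \<delta> < real N0"
    using reals_Archimedean2 by blast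
  have "norm (d / real (Suc N) * (\<Sum>i<Suc N. f (real i * (d / real (Suc N)))) - integral {0..d} f) < r"
    if N: "N \<ge> N0" for N
  proof -
    define s where "s = d / real (Suc N)"
    have s0: "0 \<le> s" and sN: "real (Suc N) * s = d" using d by (auto simp: s_def)
    have "d / \<delta> < real (Suc N)" using N0 N by linarith
    then have s\<delta>: "s < \<delta>" using \<delta> by (simp add: s_def field_simps)
    have le: "real k * s \<le> d" if "k \<le> Suc N" for k
      using mult_right_mono[of "real k" "real (Suc N)" s] that s0 sN by simp
    \<comment> \<open>Induction on the number of cells already covered; the error grows by at most
      \<open>s * e\<close> per cell.\<close>
    have *: "\<bar>integral {0..real k * s} f - s * (\<Sum>i<k. f (real i * s))\<bar> \<le> real k * s * e"
      if "k \<le> Suc N" for k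
      using that
    proof (induction k)
      case (Suc k)
      let ?a = "real k * s" and ?b = "real (Suc k) * s"
      have ab: "?a \<le> ?b" "0 \<le> ?a" and bd: "?b \<le> d" and ba: "?b - ?a = s"
        using s0 le[OF Suc.prems] by (auto simp: algebra_simps)
      have int: "f integrable_on {0..?b}" "f integrable_on {?a..?b}"
        using f ab bd by (auto intro!: integrable_continuous_interval elim: continuous_on_subset)
      have "integral {0..?b} f = integral {0..?a} f + integral {?a..?b} f"
        using Henstock_Kurzweil_Integration.integral_combine[OF ab(2,1) int(1)] by simp
      moreover have "norm (integral {?a..?b} (\<lambda>u. f u - f ?a)) \<le> e * (?b - ?a)"
      proof (rule integral_bound[OF ab(1)])
        show "continuous_on {?a..?b} (\<lambda>u. f u - f ?a)"
          using f ab bd by (auto intro!: continuous_intros elim: continuous_on_subset)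
        fix u assume "u \<in> {?a..?b}"
        then have "dist (f u) (f ?a) < e"
          using ab bd s\<delta> ba by (intro close) (auto simp: dist_real_def intro: order_trans[OF ab(2)])
        then show "norm (f u - f ?a) \<le> e" by (simp add: dist_real_def)
      qed
      then have "\<bar>integral {?a..?b} f - s * f ?a\<bar> \<le> s * e"
        using Henstock_Kurzweil_Integration.integral_diff[OF int(2) integrable_const_ivl[of "f ?a"]] ab ba
        by (simp add: mult.commute)
      moreover have "\<bar>integral {0..?a} f - s * (\<Sum>i<k. f (real i * s))\<bar> \<le> ?a * e"
        using Suc by simp
      ultimately show ?case
        by (simp add: algebra_simps abs_le_iff)
    qed simp
    show ?thesis
      unfolding s_def[symmetric] real_norm_def using *[of "Suc N"] sN de by (simp only: abs_minus_commute) simp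
  qed
  then show "\<exists>no. \<forall>N\<ge>no. norm (d / real (Suc N) * (\<Sum>i<Suc N. f (real i * (d / real (Suc N)))) - integral {0..d} f) < r"
    by blast
qed

text \<open>Riemann sums and Fatou's lemma replace Fubini's theorem, so that no joint measurability of
  \<open>g\<close> is needed; \<open>J\<close> is a measurable version of the pathwise integral, which need not be
  measurable itself because \<open>M\<close> need not be complete.\<close>

lemma square_moment_integral:
  fixes g :: "real \<Rightarrow> 'w \<Rightarrow> real"
  assumes d: "0 \<le> d" and K: "0 \<le> K"
    and meas: "\<And>u. u \<in> {0..d} \<Longrightarrow> g u \<in> borel_measurable M"
    and int: "\<And>u. u \<in> {0..d} \<Longrightarrow> integrable M (\<lambda>\<omega>. (g u \<omega>)\<^sup>2)"
    and le: "\<And>u. u \<in> {0..d} \<Longrightarrow> (LINT \<omega>|M. (g u \<omega>)\<^sup>2) \<le> K"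
    and cont: "AE \<omega> in M. continuous_on {0..d} (\<lambda>u. g u \<omega>)"
  obtains J where "J \<in> borel_measurable M" "AE \<omega> in M. J \<omega> = integral {0..d} (\<lambda>u. g u \<omega>)"
    "integrable M (\<lambda>\<omega>. (J \<omega>)\<^sup>2)" "(LINT \<omega>|M. (J \<omega>)\<^sup>2) \<le> d\<^sup>2 * K"
proof -
  define s where "s N = d / real (Suc N)" for N
  define R where "R N \<omega> = s N * (\<Sum>i<Suc N. g (real i * s N) \<omega>)" for N \<omega>
  \<comment> \<open>\<open>lim\<close> of a sequence of measurable functions is measurable even
    where the sequence diverges, and here that happens only on a null set.\<close>
  define J where "J \<omega> = lim (\<lambda>N. R N \<omega>)" for \<omega>
  have mem: "real i * s N \<in> {0..d}" if "i < Suc N" for i N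
    using d mult_right_mono[of "real i" "real (Suc N)" "s N"] that by (auto simp: s_def)
  have [measurable]: "R N \<in> borel_measurable M" for N
    unfolding R_def using meas mem by (intro borel_measurable_times borel_measurable_sum) auto
  have J[measurable]: "J \<in> borel_measurable M"
    unfolding J_def by measurable
  have lim: "AE \<omega> in M. (\<lambda>N. R N \<omega>) \<longlonglongrightarrow> integral {0..d} (\<lambda>u. g u \<omega>)"
    using cont unfolding R_def s_def
    by (elim AE_mp) (use riemann_sum_tendsto[OF d] in blast)
  have JAE: "AE \<omega> in M. J \<omega> = integral {0..d} (\<lambda>u. g u \<omega>)"
    using lim by eventually_elim (auto simp: J_def dest: limI)
  have RN: "(\<integral>\<^sup>+\<omega>. ennreal ((R N \<omega>)\<^sup>2) \<partial>M) \<le> ennreal (d\<^sup>2 * K)" for N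
  proof -
    \<comment> \<open>Cauchy-Schwarz for the finite sum; \<open>s N * real (Suc N) = d\<close> turns
      the prefactor into \<open>s N * d\<close>.\<close>
    have pt: "(R N \<omega>)\<^sup>2 \<le> s N * d * (\<Sum>i<Suc N. (g (real i * s N) \<omega>)\<^sup>2)" for \<omega>
    proof -
      have "(R N \<omega>)\<^sup>2 \<le> (s N)\<^sup>2 * (real (Suc N) * (\<Sum>i<Suc N. (g (real i * s N) \<omega>)\<^sup>2))"
        unfolding R_def power_mult_distrib
        using sum_squared_le_sum_of_squares[of "\<lambda>i. g (real i * s N) \<omega>" "{..<Suc N}"]
        by (intro mult_left_mono) (auto simp: mult.commute)
      also have "\<dots> = s N * d * (\<Sum>i<Suc N. (g (real i * s N) \<omega>)\<^sup>2)"
        by (simp add: s_def power2_eq_square)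
      finally show ?thesis .
    qed
    have s0: "0 \<le> s N" using d by (simp add: s_def)
    have intg: "integrable M (\<lambda>\<omega>. s N * d * (\<Sum>i<Suc N. (g (real i * s N) \<omega>)\<^sup>2))"
      using int mem by (intro integrable_mult_right Bochner_Integration.integrable_sum) auto
    have "(\<integral>\<^sup>+\<omega>. ennreal ((R N \<omega>)\<^sup>2) \<partial>M) \<le> (\<integral>\<^sup>+\<omega>. ennreal (s N * d * (\<Sum>i<Suc N. (g (real i * s N) \<omega>)\<^sup>2)) \<partial>M)"
      using pt by (intro nn_integral_mono ennreal_leI) auto
    also have "\<dots> = ennreal (LINT \<omega>|M. s N * d * (\<Sum>i<Suc N. (g (real i * s N) \<omega>)\<^sup>2))"
      using intg s0 d by (intro nn_integral_eq_integral AE_I2 mult_nonneg_nonneg sum_nonneg) auto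
    also have "(LINT \<omega>|M. s N * d * (\<Sum>i<Suc N. (g (real i * s N) \<omega>)\<^sup>2)) =
        s N * d * (\<Sum>i<Suc N. (LINT \<omega>|M. (g (real i * s N) \<omega>)\<^sup>2))"
      using int mem by (subst integral_mult_right_zero, subst Bochner_Integration.integral_sum) auto
    also have "\<dots> \<le> s N * d * (\<Sum>i<Suc N. K)"
      using s0 d le mem by (intro mult_left_mono sum_mono) auto
    also have "\<dots> = d\<^sup>2 * K"
      by (simp add: s_def power2_eq_square)
    finally show ?thesis by (simp add: ennreal_leI)
  qed
  \<comment> \<open>Almost surely the squared Riemann sums converge to the square of
    \<open>J\<close>, so Fatou's lemma passes their common bound on to \<open>J\<close>.\<close>
  have "(\<integral>\<^sup>+\<omega>. ennreal ((J \<omega>)\<^sup>2) \<partial>M) = (\<integral>\<^sup>+\<omega>. liminf (\<lambda>N. ennreal ((R N \<omega>)\<^sup>2)) \<partial>M)"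
  proof (rule nn_integral_cong_AE)
    show "AE \<omega> in M. ennreal ((J \<omega>)\<^sup>2) = liminf (\<lambda>N. ennreal ((R N \<omega>)\<^sup>2))"
      using lim JAE
    proof eventually_elim
      case (elim \<omega>)
      then have "(\<lambda>N. ennreal ((R N \<omega>)\<^sup>2)) \<longlonglongrightarrow> ennreal ((J \<omega>)\<^sup>2)"
        by (auto intro!: tendsto_intros)
      then show ?case by (intro lim_imp_Liminf[symmetric]) auto
    qed
  qed
  also have "\<dots> \<le> liminf (\<lambda>N. \<integral>\<^sup>+\<omega>. ennreal ((R N \<omega>)\<^sup>2) \<partial>M)"
    by (intro nn_integral_liminf) measurable
  also have "\<dots> \<le> ennreal (d\<^sup>2 * K)"
    using RN by (intro Liminf_le) (auto intro!: eventually_frequently)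
  finally have bound: "(\<integral>\<^sup>+\<omega>. ennreal ((J \<omega>)\<^sup>2) \<partial>M) \<le> ennreal (d\<^sup>2 * K)" .
  have "integrable M (\<lambda>\<omega>. (J \<omega>)\<^sup>2)"
    using bound by (intro integrableI_bounded) (auto simp: le_less_trans[OF _ ennreal_less_top])
  moreover have "(LINT \<omega>|M. (J \<omega>)\<^sup>2) \<le> d\<^sup>2 * K"
    using K bound by (intro integral_real_bounded) auto
  ultimately show ?thesis using that J JAE by blast
qed

subsection \<open>The Euler scheme along a single path\<close>

text \<open>Gronwall's inequality for the running integral of \<open>\<bar>x\<bar>\<close>. The
  noise enters only through its L1 norm, whose mean square follows from second moments at fixed
  times, without any estimate on the supremum of a path.\<close>

lemma linear_sde_L1_bound:
  fixes x b :: "real \<Rightarrow> real"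
  assumes T: "0 \<le> T" and x: "continuous_on {0..T} x" and b: "continuous_on {0..T} b"
    and eq: "\<And>t. t \<in> {0..T} \<Longrightarrow> x t = x0 + integral {0..t} (\<lambda>s. A * x s) + \<sigma> * b t"
  shows "integral {0..T} (\<lambda>s. \<bar>x s\<bar>) \<le>
    exp (\<bar>A\<bar> * T) * (\<bar>x0\<bar> * T + \<bar>\<sigma>\<bar> * integral {0..T} (\<lambda>s. \<bar>b s\<bar>))"
proof -
  define J where "J t = integral {0..t} (\<lambda>s. \<bar>x s\<bar>)" for t
  define \<beta> where "\<beta> t = integral {0..t} (\<lambda>s. \<bar>b s\<bar>)" for t
  have xa: "continuous_on {0..T} (\<lambda>s. \<bar>x s\<bar>)" and ba: "continuous_on {0..T} (\<lambda>s. \<bar>b s\<bar>)"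
    using x b by (auto intro!: continuous_intros)
  have dJ: "(J has_real_derivative \<bar>x t\<bar>) (at t within {0..T})"
    and d\<beta>: "(\<beta> has_real_derivative \<bar>b t\<bar>) (at t within {0..T})" if "t \<in> {0..T}" for t
    unfolding J_def \<beta>_def using that xa ba by (auto intro: integral_has_real_derivative)
  \<comment> \<open>The integrating factor \<open>exp (- \<bar>A\<bar> * t)\<close> absorbs the term
    \<open>\<bar>A\<bar> * J t\<close> of the integral equation and is at most 1 on the remaining
    terms, so \<open>D\<close>, the derivative of \<open>F\<close>, is nonpositive; moreover
    \<open>F 0 = 0\<close>.\<close>
  define F where "F t = exp (- \<bar>A\<bar> * t) * J t - \<bar>x0\<bar> * t - \<bar>\<sigma>\<bar> * \<beta> t" for t
  define D where "D t = exp (- \<bar>A\<bar> * t) * (\<bar>x t\<bar> - \<bar>A\<bar> * J t) - \<bar>x0\<bar> - \<bar>\<sigma>\<bar> * \<bar>b t\<bar>" for t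
  have dF: "(F has_real_derivative D t) (at t within {0..T})" if "t \<in> {0..T}" for t
    unfolding F_def D_def
    by (rule derivative_eq_intros dJ d\<beta> that refl | simp add: algebra_simps)+
  have D: "D t \<le> 0" if t: "t \<in> {0..T}" for t
  proof -
    have "continuous_on {0..t} x"
      using t by (intro continuous_on_subset[OF x]) auto
    then have "\<bar>integral {0..t} x\<bar> \<le> J t"
      unfolding J_def
      using Henstock_Kurzweil_Integration.integral_norm_bound_integral[of x "{0..t}" "\<lambda>s. \<bar>x s\<bar>"]
      by (auto intro!: integrable_continuous_interval continuous_intros)
    then have "\<bar>A\<bar> * \<bar>integral {0..t} x\<bar> \<le> \<bar>A\<bar> * J t"
      by (intro mult_left_mono) auto
    then have *: "\<bar>x t\<bar> - \<bar>A\<bar> * J t \<le> \<bar>x0\<bar> + \<bar>\<sigma>\<bar> * \<bar>b t\<bar>"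
      using eq[OF t] abs_triangle_ineq[of "x0 + A * integral {0..t} x" "\<sigma> * b t"]
        abs_triangle_ineq[of x0 "A * integral {0..t} x"] by (simp add: abs_mult)
    have "exp (- \<bar>A\<bar> * t) * (\<bar>x t\<bar> - \<bar>A\<bar> * J t) \<le> exp (- \<bar>A\<bar> * t) * (\<bar>x0\<bar> + \<bar>\<sigma>\<bar> * \<bar>b t\<bar>)"
      using * by (intro mult_left_mono) auto
    also have "\<dots> \<le> 1 * (\<bar>x0\<bar> + \<bar>\<sigma>\<bar> * \<bar>b t\<bar>)"
      using t by (intro mult_right_mono) auto
    finally show ?thesis by (simp add: D_def)
  qed
  have "F T \<le> F 0"
  proof (rule DERIV_nonpos_imp_decreasing_open[OF T])
    show "continuous_on {0..T} F"
      using dF by (intro DERIV_continuous_on) auto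
    fix t assume t: "0 < t" "t < T"
    then have "(F has_real_derivative D t) (at t)"
      using dF[of t] at_within_Icc_at[of 0 t T] by auto
    then show "\<exists>y. (F has_real_derivative y) (at t) \<and> y \<le> 0" using D[of t] t by auto
  qed
  then have "exp (- \<bar>A\<bar> * T) * J T \<le> \<bar>x0\<bar> * T + \<bar>\<sigma>\<bar> * \<beta> T"
    by (simp add: F_def J_def \<beta>_def)
  then show ?thesis
    by (simp add: J_def \<beta>_def exp_minus field_simps)
qed

text \<open>The increment \<open>x (s + u) - x s\<close> is a drift integral plus a noise increment.
  The noise part is kept exactly, since its size is only controlled after summation over steps. The
  drift part costs a second factor \<open>A\<close> and the L1 mass of \<open>x\<close> on this
  step, a bound that is additive over steps.\<close>

lemma linear_euler_step:
  fixes x b :: "real \<Rightarrow> real"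
  assumes x: "continuous_on {0..T} x" and b: "continuous_on {0..T} b"
    and eq: "\<And>t. t \<in> {0..T} \<Longrightarrow> x t = x0 + integral {0..t} (\<lambda>s. A * x s) + \<sigma> * b t"
    and s: "0 \<le> s" "0 \<le> v" "s + v \<le> T"
  shows "\<bar>x (s + v) - (y + A * y * v + \<sigma> * (b (s + v) - b s)) - (1 + A * v) * (x s - y)
      - A * \<sigma> * integral {0..v} (\<lambda>u. b (s + u) - b s)\<bar> \<le> A\<^sup>2 * v * integral {s..s + v} (\<lambda>u. \<bar>x u\<bar>)"
proof -
  define L where "L = integral {s..s + v} (\<lambda>u. \<bar>x u\<bar>)"
  have xi: "x integrable_on {p..q}" and xai: "(\<lambda>u. \<bar>x u\<bar>) integrable_on {p..q}" if "0 \<le> p" "q \<le> T" for p q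
    using that by (auto intro!: integrable_continuous_interval continuous_intros continuous_on_subset[OF x])
  have inc: "x (s + u) - x s = A * integral {s..s + u} x + \<sigma> * (b (s + u) - b s)"
    if "0 \<le> u" "u \<le> v" for u
  proof -
    have "integral {0..s} x + integral {s..s + u} x = integral {0..s + u} x"
      using that s by (intro Henstock_Kurzweil_Integration.integral_combine xi) auto
    then show ?thesis
      using eq[of s] eq[of "s + u"] that s by (simp add: algebra_simps flip: distrib_left)
  qed
  have shift: "integral {0..v} (\<lambda>u. x (s + u)) = integral {s..s + v} x"
    using has_integral_shift_Icc_real[of x s "integral {s..s + v} x" 0 v] xi[of s "s + v"] s
    by (simp add: comp_def add.commute integral_unique integrable_integral)
  have cx: "continuous_on {0..v} (\<lambda>u. x (s + u))" and cb: "continuous_on {0..v} (\<lambda>u. b (s + u))"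
    using s by (auto intro!: continuous_on_compose2[OF x] continuous_on_compose2[OF b] continuous_intros)
  \<comment> \<open>With the noise removed, the integrand is \<open>A\<close> times the integral of
    \<open>x\<close> over \<open>{s..s + u}\<close>, hence at most \<open>\<bar>A\<bar> * L\<close>
    throughout the step.\<close>
  have "norm (integral {0..v} (\<lambda>u. x (s + u) - x s - \<sigma> * (b (s + u) - b s))) \<le> \<bar>A\<bar> * L * (v - 0)"
  proof (rule integral_bound[OF s(2)])
    show "continuous_on {0..v} (\<lambda>u. x (s + u) - x s - \<sigma> * (b (s + u) - b s))"
      by (intro continuous_intros cx cb)
    fix u assume u: "u \<in> {0..v}"
    have "\<bar>integral {s..s + u} x\<bar> \<le> integral {s..s + u} (\<lambda>u. \<bar>x u\<bar>)"
      using u s Henstock_Kurzweil_Integration.integral_norm_bound_integral[of x "{s..s+u}" "\<lambda>s. \<bar>x s\<bar>"] by (simp add: xi xai)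
    also have "\<dots> \<le> L"
      unfolding L_def using u s by (intro integral_subset_le xai) auto
    finally have "\<bar>A\<bar> * \<bar>integral {s..s + u} x\<bar> \<le> \<bar>A\<bar> * L" by (intro mult_left_mono) auto
    then show "norm (x (s + u) - x s - \<sigma> * (b (s + u) - b s)) \<le> \<bar>A\<bar> * L"
      using inc[of u] u by (simp add: abs_mult)
  qed
  moreover have "integral {0..v} (\<lambda>u. x (s + u) - x s - \<sigma> * (b (s + u) - b s)) =
     integral {s..s + v} x - v * x s - \<sigma> * integral {0..v} (\<lambda>u. b (s + u) - b s)"
  proof -
    have "integral {0..v} (\<lambda>u. x (s + u) - x s - \<sigma> * (b (s + u) - b s)) =
      integral {0..v} (\<lambda>u. x (s + u)) - integral {0..v} (\<lambda>u. x s) - integral {0..v} (\<lambda>u. \<sigma> * (b (s + u) - b s))"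
      by (subst Henstock_Kurzweil_Integration.integral_diff Henstock_Kurzweil_Integration.integral_diff | intro integrable_continuous_interval continuous_intros cx cb refl)+
    then show ?thesis using shift s by simp
  qed
  ultimately have "\<bar>integral {s..s + v} x - v * x s - \<sigma> * integral {0..v} (\<lambda>u. b (s + u) - b s)\<bar> \<le> \<bar>A\<bar> * L * v"
    by simp
  then have "\<bar>A\<bar> * \<bar>integral {s..s + v} x - v * x s - \<sigma> * integral {0..v} (\<lambda>u. b (s + u) - b s)\<bar> \<le> \<bar>A\<bar> * (\<bar>A\<bar> * L * v)"
    by (intro mult_left_mono) auto
  \<comment> \<open>The noise increment is common to solution and scheme and cancels, which leaves
    \<open>A\<close> times the remainder just estimated.\<close>
  moreover have "x (s + v) - (y + A * y * v + \<sigma> * (b (s + v) - b s)) - (1 + A * v) * (x s - y)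
      - A * \<sigma> * integral {0..v} (\<lambda>u. b (s + u) - b s)
      = A * (integral {s..s + v} x - v * x s - \<sigma> * integral {0..v} (\<lambda>u. b (s + u) - b s))"
    using inc[of v] s by (simp add: algebra_simps)
  moreover have "A\<^sup>2 = \<bar>A\<bar> * \<bar>A\<bar>"
    by (simp add: power2_eq_square)
  ultimately show ?thesis
    by (simp only: L_def abs_mult mult_ac)
qed

text \<open>Discrete variation of constants. The three summands are the accumulated drift
  remainders, the noise of the \<open>k\<close> complete steps propagated by powers of
  \<open>1 + A * h\<close>, and the noise of the last, partial step of length
  \<open>v\<close>.\<close>

lemma linear_euler_path_bound:
  fixes x b y :: "real \<Rightarrow> real" and n :: nat and T :: real
  defines "h \<equiv> T / real n"
  assumes T: "0 < T" and n: "0 < n"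
    and x: "continuous_on {0..T} x" and b: "continuous_on {0..T} b" and b0: "b 0 = 0"
    and eq: "\<And>t. t \<in> {0..T} \<Longrightarrow> x t = x0 + integral {0..t} (\<lambda>s. A * x s) + \<sigma> * b t"
    and y0: "y 0 = x0"
    and y: "\<And>k v. k < n \<Longrightarrow> v \<in> {0..h} \<Longrightarrow> y (real k * h + v) =
        y (real k * h) + A * y (real k * h) * v + \<sigma> * (b (real k * h + v) - b (real k * h))"
    and k: "k < n" and v: "v \<in> {0..h}"
  shows "\<bar>x (real k * h + v) - y (real k * h + v)\<bar> \<le>
      2 * A\<^sup>2 * exp (2 * \<bar>A\<bar> * T) * (h * integral {0..T} (\<lambda>s. \<bar>x s\<bar>))
    + \<bar>A * \<sigma>\<bar> * exp (\<bar>A\<bar> * T) * \<bar>integral {0..h} (\<lambda>u. \<Sum>j<k. (1 + A * h) ^ (k - 1 - j) *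
        (b (real j * h + u) - b (real j * h)))\<bar>
    + \<bar>A * \<sigma>\<bar> * \<bar>integral {0..v} (\<lambda>u. b (real k * h + u) - b (real k * h))\<bar>"
proof -
  have h: "0 < h" and nh: "real n * h = T" using T n by (auto simp: h_def)
  have kh: "real k * h + h \<le> T" if "k < n" for k
    using mult_right_mono[of "real (Suc k)" "real n" h] that h nh by (simp add: algebra_simps)
  define g where "g j = integral {0..h} (\<lambda>u. b (real j * h + u) - b (real j * h))" for j
  define L where "L t = integral {0..t} (\<lambda>s. \<bar>x s\<bar>)" for t
  \<comment> \<open>\<open>1 + A * h\<close> may be below 1 or even negative; \<open>q\<close>
    dominates its absolute value and is at least 1.\<close>
  define q where "q = 1 + \<bar>A\<bar> * h"
  \<comment> \<open>\<open>G\<close> solves the noise recursion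
    \<open>G (Suc k) = (1 + A * h) * G k + g k\<close> with \<open>G 0 = 0\<close>. For
    \<open>j < k\<close> the subtraction in the exponent is not truncated.\<close>
  define G where "G k = (\<Sum>j<k. (1 + A * h) ^ (k - 1 - j) * g j)" for k
  have GSuc: "G (Suc k) = (1 + A * h) * G k + g k" for k
  proof -
    have "(\<Sum>j<k. (1 + A * h) ^ (k - j) * g j) = (1 + A * h) * G k"
      unfolding G_def sum_distrib_left
    proof (rule sum.cong)
      fix j assume "j \<in> {..<k}"
      then have "k - j = Suc (k - 1 - j)" by auto
      then show "(1 + A * h) ^ (k - j) * g j = (1 + A * h) * ((1 + A * h) ^ (k - 1 - j) * g j)" by simp
    qed simp
    then show ?thesis by (simp add: G_def)
  qed
  have cb: "continuous_on {0..h} (\<lambda>u. b (real j * h + u))" if "j < n" for j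
    using kh[OF that] h by (auto intro!: continuous_on_compose2[OF b] continuous_intros)
  have Gint: "integral {0..h} (\<lambda>u. \<Sum>j<k. (1 + A * h) ^ (k - 1 - j) * (b (real j * h + u) - b (real j * h))) = G k"
    using k unfolding G_def g_def
    by (subst Henstock_Kurzweil_Integration.integral_sum) (auto intro!: integrable_continuous_interval continuous_intros cb)
  have Lint: "(\<lambda>u. \<bar>x u\<bar>) integrable_on {p..r}" if "0 \<le> p" "r \<le> T" for p r
    using that by (auto intro!: integrable_continuous_interval continuous_intros continuous_on_subset[OF x])
  have Lmono: "L p \<le> L r" if "0 \<le> p" "p \<le> r" "r \<le> T" for p r
    unfolding L_def using that by (intro integral_subset_le Lint) auto
  have L0: "0 \<le> L p" if "0 \<le> p" "p \<le> T" for p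
    unfolding L_def using that by (intro integral_nonneg Lint) auto
  have Ladd: "integral {p..r} (\<lambda>s. \<bar>x s\<bar>) = L r - L p" if "0 \<le> p" "p \<le> r" "r \<le> T" for p r
    using Henstock_Kurzweil_Integration.integral_combine[OF that(1,2) Lint[OF _ that(3)]] by (simp add: L_def)
  have q1: "1 \<le> q" and qA: "\<bar>1 + A * h\<bar> \<le> q"
    using h by (auto simp: q_def abs_mult intro: order_trans[OF abs_triangle_ineq])
  have step: "\<bar>x (real k * h + v) - y (real k * h + v) - (1 + A * v) * (x (real k * h) - y (real k * h))
      - A * \<sigma> * integral {0..v} (\<lambda>u. b (real k * h + u) - b (real k * h))\<bar>
      \<le> A\<^sup>2 * v * (L (real k * h + v) - L (real k * h))" if "k < n" "v \<in> {0..h}" for k v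
  proof -
    have "0 \<le> real k * h" "0 \<le> v" "real k * h + v \<le> T" using that kh[OF that(1)] h by auto
    from linear_euler_step[OF x b eq this, of "y (real k * h)"] Ladd[of "real k * h" "real k * h + v"] this
    show ?thesis unfolding y[OF that] by simp
  qed
  \<comment> \<open>The remainder of each step is its own L1 mass, so the masses telescope to
    \<open>L (real k * h)\<close>; since \<open>q\<close> is at least 1, each new remainder may be
    enlarged by \<open>q ^ Suc k\<close> and merged with the propagated ones.\<close>
  have grid: "\<bar>x (real k * h) - y (real k * h) - A * \<sigma> * G k\<bar> \<le> q ^ k * (A\<^sup>2 * h * L (real k * h))"
    if "k \<le> n" for k
    using that
  proof (induction k)
    case 0
    then show ?case using eq[of 0] T b0 y0 by (simp add: G_def L_def)
  next
    case (Suc k)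
    define e where "e = x (real k * h) - y (real k * h)"
    define e' where "e' = x (real (Suc k) * h) - y (real (Suc k) * h)"
    have Sk: "real (Suc k) * h = real k * h + h" by (simp add: algebra_simps)
    have bnds: "0 \<le> real k * h" "real k * h \<le> T" "real k * h + h \<le> T"
      using kh[of k] Suc.prems h by auto
    have "\<bar>e' - (1 + A * h) * e - A * \<sigma> * g k\<bar> \<le> A\<^sup>2 * h * (L (real (Suc k) * h) - L (real k * h))"
      using step[of k h] Suc.prems h unfolding e_def e'_def g_def Sk by simp
    also have "\<dots> \<le> q ^ Suc k * (A\<^sup>2 * h * (L (real (Suc k) * h) - L (real k * h)))"
      using mult_right_mono[OF one_le_power[OF q1, of "Suc k"], of "A\<^sup>2 * h * (L (real (Suc k) * h) - L (real k * h))"]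
        h Lmono[of "real k * h" "real k * h + h"] bnds by (simp only: Sk) simp
    finally have 1: "\<bar>e' - (1 + A * h) * e - A * \<sigma> * g k\<bar> \<le>
        q ^ Suc k * (A\<^sup>2 * h * (L (real (Suc k) * h) - L (real k * h)))" .
    have "\<bar>1 + A * h\<bar> * \<bar>e - A * \<sigma> * G k\<bar> \<le> q * (q ^ k * (A\<^sup>2 * h * L (real k * h)))"
      using Suc qA q1 unfolding e_def by (intro mult_mono) auto
    then have 2: "\<bar>(1 + A * h) * (e - A * \<sigma> * G k)\<bar> \<le> q ^ Suc k * (A\<^sup>2 * h * L (real k * h))"
      by (simp add: abs_mult mult_ac)
    have "e' - A * \<sigma> * G (Suc k) = (e' - (1 + A * h) * e - A * \<sigma> * g k) + (1 + A * h) * (e - A * \<sigma> * G k)"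
      unfolding GSuc by (simp add: algebra_simps)
    then have "\<bar>e' - A * \<sigma> * G (Suc k)\<bar> \<le> \<bar>e' - (1 + A * h) * e - A * \<sigma> * g k\<bar> + \<bar>(1 + A * h) * (e - A * \<sigma> * G k)\<bar>"
      by (metis abs_triangle_ineq)
    also have "\<dots> \<le> q ^ Suc k * (A\<^sup>2 * h * (L (real (Suc k) * h) - L (real k * h))) + q ^ Suc k * (A\<^sup>2 * h * L (real k * h))"
      using 1 2 by (rule add_mono)
    also have "\<dots> = q ^ Suc k * (A\<^sup>2 * h * L (real (Suc k) * h))" by (simp add: ring_distribs)
    finally show ?case by (simp only: e'_def)
  qed
  define E where "E = exp (\<bar>A\<bar> * T)"
  have E1: "1 \<le> E" using T by (simp add: E_def)
  \<comment> \<open>The growth factor stays bounded uniformly in the step size because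
    \<open>k\<close> steps of length \<open>h\<close> fit into \<open>T\<close>.\<close>
  have qE: "q ^ k \<le> E"
  proof -
    have "q ^ k \<le> exp (\<bar>A\<bar> * h) ^ k" using q1 by (intro power_mono) (auto simp: q_def exp_ge_add_one_self)
    also have "\<dots> = exp (\<bar>A\<bar> * (real k * h))" by (simp add: exp_of_nat_mult[symmetric] mult_ac)
    also have "\<dots> \<le> E" using kh[OF k] h unfolding E_def by (intro exp_le_cancel_iff[THEN iffD2] mult_left_mono) auto
    finally show ?thesis .
  qed
  have hT: "h \<le> T" using kh[OF n] by simp
  have vE: "\<bar>1 + A * v\<bar> \<le> E"
  proof -
    have "\<bar>1 + A * v\<bar> \<le> 1 + \<bar>A\<bar> * T"
      using v hT mult_left_mono[of v T "\<bar>A\<bar>"] by (intro order_trans[OF abs_triangle_ineq]) (auto simp: abs_mult)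
    also have "\<dots> \<le> E" unfolding E_def by (rule exp_ge_add_one_self)
    finally show ?thesis .
  qed
  have bnds: "0 \<le> real k * h" "real k * h \<le> T" "real k * h + v \<le> T" "0 \<le> v" "v \<le> h"
    using kh[OF k] h v by auto
  define e where "e = x (real k * h) - y (real k * h)"
  define P where "P = integral {0..v} (\<lambda>u. b (real k * h + u) - b (real k * h))"
  have "q ^ k * (A\<^sup>2 * h * L (real k * h)) \<le> E * (A\<^sup>2 * h * L T)"
    using qE E1 h L0 Lmono bnds by (intro mult_mono) auto
  then have "\<bar>e - A * \<sigma> * G k\<bar> \<le> E * (A\<^sup>2 * h * L T)"
    using grid[of k] k by (simp add: e_def)
  then have e: "\<bar>e\<bar> \<le> E * (A\<^sup>2 * h * L T) + \<bar>A * \<sigma>\<bar> * \<bar>G k\<bar>"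
    by (simp only: abs_mult[symmetric])
  have "A\<^sup>2 * v * (L (real k * h + v) - L (real k * h)) \<le> A\<^sup>2 * h * L T"
    using bnds h L0[of "real k * h"] Lmono[of "real k * h + v" T] Lmono[of "real k * h" "real k * h + v"]
    by (intro mult_mono) auto
  then have "\<bar>x (real k * h + v) - y (real k * h + v)\<bar> \<le> \<bar>(1 + A * v) * e\<bar> + \<bar>A * \<sigma> * P\<bar> + A\<^sup>2 * h * L T"
    using step[OF k v] unfolding e_def P_def by linarith
  moreover have "\<bar>(1 + A * v) * e\<bar> \<le> E * (E * (A\<^sup>2 * h * L T) + \<bar>A * \<sigma>\<bar> * \<bar>G k\<bar>)"
    unfolding abs_mult[of "1 + A * v"] using vE e E1 by (intro mult_mono) auto
  \<comment> \<open>The remainder of the partial step is enlarged to the size of the propagated grid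
    remainder; together they give the factor 2 in the claim.\<close>
  moreover have "A\<^sup>2 * h * L T \<le> E\<^sup>2 * (A\<^sup>2 * h * L T)"
    using mult_right_mono[OF one_le_power[OF E1, of 2], of "A\<^sup>2 * h * L T"] h L0[of T] T by auto
  moreover have "E * (E * (A\<^sup>2 * h * L T) + \<bar>A * \<sigma>\<bar> * \<bar>G k\<bar>) =
      E\<^sup>2 * (A\<^sup>2 * h * L T) + \<bar>A * \<sigma>\<bar> * E * \<bar>G k\<bar>"
    by (simp add: power2_eq_square distrib_left)
  moreover have "2 * A\<^sup>2 * E\<^sup>2 * (h * L T) = 2 * (E\<^sup>2 * (A\<^sup>2 * h * L T))"
    by simp
  ultimately have "\<bar>x (real k * h + v) - y (real k * h + v)\<bar> \<le>
     2 * A\<^sup>2 * E\<^sup>2 * (h * L T) + \<bar>A * \<sigma>\<bar> * E * \<bar>G k\<bar> + \<bar>A * \<sigma>\<bar> * \<bar>P\<bar>"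
    unfolding abs_mult[of "A * \<sigma>" P] by linarith
  moreover have "E\<^sup>2 = exp (2 * \<bar>A\<bar> * T)"
    by (simp add: E_def power2_eq_square mult_exp_exp)
  ultimately show ?thesis unfolding Gint by (simp add: P_def L_def E_def)
qed

subsection \<open>Increments of fractional Brownian motion\<close>

text \<open>Concavity: the derivative of \<open>x powr p\<close> is nonincreasing for
  \<open>p \<le> 1\<close>. Derivatives are taken only at interior points, because
  \<open>x powr p\<close> need not be differentiable at 0; at the end points continuity
  suffices.\<close>

lemma powr_increment_antimono:
  fixes p x y d :: real
  assumes p: "0 < p" "p \<le> 1" and xy: "0 \<le> x" "x \<le> y" and d: "0 \<le> d"
  shows "(y + d) powr p - y powr p \<le> (x + d) powr p - x powr p"
proof (rule DERIV_nonpos_imp_decreasing_open[OF xy(2), where f = "\<lambda>x. (x + d) powr p - x powr p"])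
  fix u assume u: "x < u" "u < y"
  have "((\<lambda>x. (x + d) powr p - x powr p) has_real_derivative
      p * (u + d) powr (p - 1) - p * u powr (p - 1)) (at u)"
    using u xy d by (auto intro!: derivative_eq_intros)
  moreover have "(u + d) powr (p - 1) \<le> u powr (p - 1)"
    using u xy d p by (intro powr_mono2') auto
  then have "p * (u + d) powr (p - 1) - p * u powr (p - 1) \<le> 0"
    using p by (simp add: mult_left_mono)
  ultimately show "\<exists>D. ((\<lambda>x. (x + d) powr p - x powr p) has_real_derivative D) (at u) \<and> D \<le> 0"
    by blast
next
  show "continuous_on {x..y} (\<lambda>x. (x + d) powr p - x powr p)"
    using p xy d by (intro continuous_intros continuous_on_powr') auto
qed

text \<open>For \<open>p \<le> 1\<close> the increments \<open>D m\<close> decrease in \<open>m\<close> and each summand with \<open>m \<ge> 1\<close> is at most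
  \<open>(D (m - 1) - D m) / 2\<close>, so the sum telescopes.\<close>

lemma sum_abs_increment_cov_le:
  fixes p h v :: real
  assumes p: "0 < p" "p \<le> 1" and v: "0 \<le> v" "v \<le> h"
  shows "(\<Sum>m<k. \<bar>(real m * h + v) powr p + \<bar>real m * h - v\<bar> powr p - 2 * (real m * h) powr p\<bar> / 2) \<le> 3 / 2 * h powr p"
proof -
  define c where "c m = \<bar>(real m * h + v) powr p + \<bar>real m * h - v\<bar> powr p - 2 * (real m * h) powr p\<bar> / 2" for m
  define D where "D m = (real (Suc m) * h) powr p - (real (Suc m) * h - v) powr p" for m
  have ge: "v \<le> real (Suc m) * h" for m
    using v mult_right_mono[of 1 "real (Suc m)" h] by simp
  have D0: "0 \<le> D m" for m
    using ge[of m] v p unfolding D_def by (simp del: of_nat_Suc add: powr_mono2)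
  \<comment> \<open>Lag 0 is the variance \<open>v powr p\<close> of a single increment, since
    \<open>0 powr p = 0\<close>.\<close>
  have c0: "c 0 \<le> h powr p"
    using v p by (simp add: c_def powr_mono2)
  have cS: "c (Suc m) \<le> (D m - D (Suc m)) / 2" for m
  proof -
    define a where "a = real (Suc m) * h"
    have a: "v \<le> a" "real (Suc (Suc m)) * h = a + h" using ge[of m] by (auto simp: a_def algebra_simps)
    \<comment> \<open>By concavity the second difference is nonpositive, so its absolute value is
      the increment ending at \<open>a\<close> minus the one starting at \<open>a\<close>. The
      former is \<open>D m\<close>; the latter is at least \<open>D (Suc m)\<close>, because
      \<open>a + h - v\<close> lies to the right of \<open>a\<close>.\<close>
    have "(a + v) powr p - a powr p \<le> (a - v + v) powr p - (a - v) powr p"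
      using powr_increment_antimono[OF p, of "a - v" a v] a v by simp
    moreover have "(a + h - v + v) powr p - (a + h - v) powr p \<le> (a + v) powr p - a powr p"
      using powr_increment_antimono[OF p, of a "a + h - v" v] a v by simp
    ultimately show ?thesis
      unfolding c_def D_def a(2) a_def[symmetric] using a(1) v by (simp add: abs_if field_simps)
  qed
  have S: "(\<Sum>m<Suc k. c m) \<le> h powr p + (D 0 - D k) / 2" for k
  proof (induction k)
    case (Suc k)
    then show ?case using cS[of k] by (simp add: field_simps)
  qed (use c0 in simp)
  \<comment> \<open>One more nonnegative summand makes the telescoped bound available for
    \<open>k = 0\<close> too. Lag 0 contributes 1 and \<open>D 0 / 2\<close> contributes 1/2 to the
    factor 3/2.\<close>
  have "(\<Sum>m<k. c m) \<le> (\<Sum>m<Suc k. c m)"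
    by (simp add: c_def)
  moreover have "D 0 \<le> h powr p"
    by (simp add: D_def)
  ultimately have "(\<Sum>m<k. c m) \<le> h powr p + h powr p / 2"
    using D0[of k] S[of k] by argo
  then show ?thesis by (simp add: c_def)
qed

text \<open>Every distance from \<open>j\<close> occurs at most once on each side of
  \<open>j\<close>. The conditional is the distance of two naturals, and the lemma reduces a row sum
  of a stationary covariance matrix to a sum over lags.\<close>

lemma sum_dist_le:
  fixes c :: "nat \<Rightarrow> real"
  assumes "\<And>m. 0 \<le> c m" and j: "j < k"
  shows "(\<Sum>l<k. c (if l \<le> j then j - l else l - j)) \<le> 2 * (\<Sum>m<k. c m)"
proof -
  have "(\<Sum>l<k. c (if l \<le> j then j - l else l - j)) = (\<Sum>l\<in>{..j}. c (j - l)) + (\<Sum>l\<in>{j<..<k}. c (l - j))"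
  proof -
    have "{..<k} = {..j} \<union> {j<..<k}" using j by auto
    moreover have "{..j} \<inter> {j<..<k} = {}" by auto
    ultimately show ?thesis by (simp add: sum.union_disjoint)
  qed
  also have "(\<Sum>l\<in>{..j}. c (j - l)) = (\<Sum>m\<in>(\<lambda>l. j - l) ` {..j}. c m)"
    by (subst sum.reindex) (auto simp: inj_on_def)
  also have "\<dots> \<le> (\<Sum>m<k. c m)"
    using assms by (intro sum_mono2) auto
  also have "(\<Sum>l\<in>{j<..<k}. c (l - j)) = (\<Sum>m\<in>(\<lambda>l. l - j) ` {j<..<k}. c m)"
    by (subst sum.reindex) (auto simp: inj_on_def)
  also have "\<dots> \<le> (\<Sum>m<k. c m)"
    using assms by (intro sum_mono2) auto
  finally show ?thesis by simp
qed

lemma integrable_mult_of_squares: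
  fixes f g :: "'w \<Rightarrow> real"
  assumes [measurable]: "f \<in> borel_measurable M" "g \<in> borel_measurable M"
    and "integrable M (\<lambda>\<omega>. (f \<omega>)\<^sup>2)" "integrable M (\<lambda>\<omega>. (g \<omega>)\<^sup>2)"
  shows "integrable M (\<lambda>\<omega>. f \<omega> * g \<omega>)"
proof (rule Bochner_Integration.integrable_bound)
  show "integrable M (\<lambda>\<omega>. (f \<omega>)\<^sup>2 + (g \<omega>)\<^sup>2)"
    using assms by simp
  have "\<bar>f \<omega> * g \<omega>\<bar> \<le> (f \<omega>)\<^sup>2 + (g \<omega>)\<^sup>2" for \<omega>
  proof -
    have "0 \<le> \<bar>f \<omega>\<bar> * \<bar>g \<omega>\<bar>" by simp
    then show ?thesis
      using sum_squares_bound[of "\<bar>f \<omega>\<bar>" "\<bar>g \<omega>\<bar>"] unfolding abs_mult power2_abs by linarith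
  qed
  then show "AE \<omega> in M. norm (f \<omega> * g \<omega>) \<le> norm ((f \<omega>)\<^sup>2 + (g \<omega>)\<^sup>2)"
    by auto
qed measurable

section \<open>Second moments and covariances of fractional Brownian motion\<close>

text \<open>The bound \<open>H \<le> 1 / 2\<close> makes \<open>2 * H\<close> an exponent of a
  concave power.\<close>

locale fbm = prob_space M for M :: "'w measure" +
  fixes H T :: real and B :: "real \<Rightarrow> 'w \<Rightarrow> real"
  assumes fbm: "fractional_brownian_motion M H T B"
    and H: "0 < H" "H \<le> 1 / 2"
begin

lemma continuous_paths: "AE \<omega> in M. continuous_on {0..T} (\<lambda>t. B t \<omega>)"
  and B_0: "AE \<omega> in M. B 0 \<omega> = 0"
  and covariance: "s \<in> {0..T} \<Longrightarrow> t \<in> {0..T} \<Longrightarrow>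
    (LINT \<omega>|M. B s \<omega> * B t \<omega>) = (t powr (2 * H) + s powr (2 * H) - \<bar>t - s\<bar> powr (2 * H)) / 2"
  using fbm by (auto simp: fractional_brownian_motion_def)

lemma measurable_B:
  assumes "t \<in> {0..T}"
  shows "B t \<in> borel_measurable M"
proof -
  have "gaussian_process M {0..T} B"
    using fbm by (simp add: fractional_brownian_motion_def)
  \<comment> \<open>Measurability is part of \<open>gaussian_rv\<close>; a one-point combination
    with weight 1 extracts it for \<open>B t\<close>.\<close>
  then have "gaussian_rv M (\<lambda>\<omega>. \<Sum>s\<in>{t}. 1 * B s \<omega>)"
    unfolding gaussian_process_def
    by (elim allE[of _ "{t}"] allE[of _ "\<lambda>_. 1"] impE) (use assms in auto)
  then show ?thesis by (simp add: gaussian_rv_def)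
qed

lemma second_moment: "t \<in> {0..T} \<Longrightarrow> (LINT \<omega>|M. (B t \<omega>)\<^sup>2) = t powr (2 * H)"
  using covariance[of t t] by (simp add: power2_eq_square)

text \<open>A non-integrable square would have Lebesgue integral \<open>0\<close>, contradicting the covariance formula
  for \<open>t \<noteq> 0\<close>.\<close>

lemma integrable_square_B:
  assumes t: "t \<in> {0..T}"
  shows "integrable M (\<lambda>\<omega>. (B t \<omega>)\<^sup>2)"
proof (cases "t = 0")
  case True
  have "AE \<omega> in M. (B t \<omega>)\<^sup>2 = 0" using B_0 True by auto
  then have "integrable M (\<lambda>\<omega>. (B t \<omega>)\<^sup>2) \<longleftrightarrow> integrable M (\<lambda>\<omega>. 0 :: real)"
    using measurable_B[OF t] by (intro integrable_cong_AE) auto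
  then show ?thesis by simp
next
  case False
  then show ?thesis
    using second_moment[OF t] not_integrable_integral_eq[of M "\<lambda>\<omega>. (B t \<omega>)\<^sup>2"] by auto
qed

lemma integrable_mult_B:
  "s \<in> {0..T} \<Longrightarrow> t \<in> {0..T} \<Longrightarrow> integrable M (\<lambda>\<omega>. B s \<omega> * B t \<omega>)"
  by (intro integrable_mult_of_squares measurable_B integrable_square_B)

text \<open>On expanding the product, the powers of the single times cancel; only the lag
  \<open>u - s\<close> and the common length \<open>v\<close> survive, which is stationarity of the
  increments.\<close>

lemma increment_covariance:
  assumes "0 \<le> s" "0 \<le> u" "0 \<le> v" "s + v \<le> T" "u + v \<le> T"
  shows "integrable M (\<lambda>\<omega>. (B (s + v) \<omega> - B s \<omega>) * (B (u + v) \<omega> - B u \<omega>))"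
    and "(LINT \<omega>|M. (B (s + v) \<omega> - B s \<omega>) * (B (u + v) \<omega> - B u \<omega>)) =
      (\<bar>u - s + v\<bar> powr (2 * H) + \<bar>u - s - v\<bar> powr (2 * H) - 2 * \<bar>u - s\<bar> powr (2 * H)) / 2"
proof -
  have mem: "s \<in> {0..T}" "u \<in> {0..T}" "s + v \<in> {0..T}" "u + v \<in> {0..T}"
    using assms by auto
  have eq: "(B (s + v) \<omega> - B s \<omega>) * (B (u + v) \<omega> - B u \<omega>) =
      B (s + v) \<omega> * B (u + v) \<omega> - B (s + v) \<omega> * B u \<omega> - (B s \<omega> * B (u + v) \<omega> - B s \<omega> * B u \<omega>)" for \<omega>
    by (simp add: algebra_simps)
  show "integrable M (\<lambda>\<omega>. (B (s + v) \<omega> - B s \<omega>) * (B (u + v) \<omega> - B u \<omega>))"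
    unfolding eq by (intro Bochner_Integration.integrable_diff integrable_mult_B mem)
  have "(LINT \<omega>|M. (B (s + v) \<omega> - B s \<omega>) * (B (u + v) \<omega> - B u \<omega>)) =
      (LINT \<omega>|M. B (s + v) \<omega> * B (u + v) \<omega>) - (LINT \<omega>|M. B (s + v) \<omega> * B u \<omega>)
      - ((LINT \<omega>|M. B s \<omega> * B (u + v) \<omega>) - (LINT \<omega>|M. B s \<omega> * B u \<omega>))"
    unfolding eq
    by (subst Bochner_Integration.integral_diff |
        intro Bochner_Integration.integrable_diff integrable_mult_B mem refl)+
  also have "\<dots> = (\<bar>u - s + v\<bar> powr (2 * H) + \<bar>u - s - v\<bar> powr (2 * H) - 2 * \<bar>u - s\<bar> powr (2 * H)) / 2"
    unfolding covariance[OF mem(3,4)] covariance[OF mem(3,2)] covariance[OF mem(1,4)] covariance[OF mem(1,2)]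
    by (simp add: algebra_simps diff_divide_distrib add_divide_distrib)
  finally show "(LINT \<omega>|M. (B (s + v) \<omega> - B s \<omega>) * (B (u + v) \<omega> - B u \<omega>)) =
      (\<bar>u - s + v\<bar> powr (2 * H) + \<bar>u - s - v\<bar> powr (2 * H) - 2 * \<bar>u - s\<bar> powr (2 * H)) / 2" .
qed

lemma second_moment_increment:
  assumes "0 \<le> s" "0 \<le> v" "s + v \<le> T"
  shows "integrable M (\<lambda>\<omega>. (B (s + v) \<omega> - B s \<omega>)\<^sup>2)"
    and "(LINT \<omega>|M. (B (s + v) \<omega> - B s \<omega>)\<^sup>2) = v powr (2 * H)"
  using increment_covariance[of s s v] assms by (auto simp: power2_eq_square)

text \<open>A row-sum estimate for the covariance matrix: each row of absolute covariances is at
  most \<open>3 * h powr (2 * H)\<close>, so the variance grows like \<open>k\<close>, not like the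
  square of \<open>k\<close>. The bound is uniform in the offset \<open>v\<close>, as needed for
  integrating over it.\<close>

lemma second_moment_weighted_increments:
  assumes v: "0 \<le> v" "v \<le> h" and kh: "real k * h \<le> T" and W: "\<And>j. j < k \<Longrightarrow> \<bar>w j\<bar> \<le> W"
  shows "integrable M (\<lambda>\<omega>. (\<Sum>j<k. w j * (B (real j * h + v) \<omega> - B (real j * h) \<omega>))\<^sup>2)"
    and "(LINT \<omega>|M. (\<Sum>j<k. w j * (B (real j * h + v) \<omega> - B (real j * h) \<omega>))\<^sup>2) \<le>
      3 * W\<^sup>2 * real k * h powr (2 * H)"
proof -
  define Z where "Z j \<omega> = B (real j * h + v) \<omega> - B (real j * h) \<omega>" for j \<omega>
  define c where "c m = \<bar>(real m * h + v) powr (2 * H) + \<bar>real m * h - v\<bar> powr (2 * H) - 2 * (real m * h) powr (2 * H)\<bar> / 2" for m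
  have h: "0 \<le> h" using v by simp
  have mem: "0 \<le> real j * h" "real j * h + v \<le> T" if "j < k" for j
  proof -
    have "real (Suc j) * h \<le> real k * h" using that h by (intro mult_right_mono) auto
    then show "0 \<le> real j * h" "real j * h + v \<le> T" using h v kh by (auto simp: algebra_simps)
  qed
  have int: "integrable M (\<lambda>\<omega>. Z j \<omega> * Z l \<omega>)" if "j < k" "l < k" for j l
    unfolding Z_def using that mem v by (intro increment_covariance) auto
  \<comment> \<open>The covariance depends only on the lag; the two cases resolve its sign, since
    lags are expressed by subtraction of naturals.\<close>
  have cov: "\<bar>LINT \<omega>|M. Z j \<omega> * Z l \<omega>\<bar> = c (if l \<le> j then j - l else l - j)" if "j < k" "l < k" for j l
  proof (cases "l \<le> j")
    case True
    then obtain m where m: "j = l + m" using le_Suc_ex by blast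
    have "real l * h - real j * h = - (real m * h)" "0 \<le> real m * h"
      using h by (auto simp: m algebra_simps)
    then have "(LINT \<omega>|M. Z j \<omega> * Z l \<omega>) = (\<bar>- (real m * h) + v\<bar> powr (2 * H) + \<bar>- (real m * h) - v\<bar> powr (2 * H) - 2 * (real m * h) powr (2 * H)) / 2"
      unfolding Z_def using that mem v by (subst increment_covariance(2)) auto
    moreover have "\<bar>- (real m * h) + v\<bar> = \<bar>real m * h - v\<bar>" "\<bar>- (real m * h) - v\<bar> = real m * h + v"
      using \<open>0 \<le> real m * h\<close> v by linarith+
    ultimately show ?thesis by (simp add: m c_def add.commute)
  next
    case False
    then obtain m where m: "l = j + m" using le_Suc_ex by (metis nat_le_linear)
    have "real l * h - real j * h = real m * h" "0 \<le> real m * h"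
      using h by (auto simp: m algebra_simps)
    then have "(LINT \<omega>|M. Z j \<omega> * Z l \<omega>) = (\<bar>real m * h + v\<bar> powr (2 * H) + \<bar>real m * h - v\<bar> powr (2 * H) - 2 * (real m * h) powr (2 * H)) / 2"
      unfolding Z_def using that mem v by (subst increment_covariance(2)) auto
    then show ?thesis using \<open>0 \<le> real m * h\<close> v False by (simp add: m c_def)
  qed
  have eq: "(\<Sum>j<k. w j * Z j \<omega>)\<^sup>2 = (\<Sum>j<k. \<Sum>l<k. w j * w l * (Z j \<omega> * Z l \<omega>))" for \<omega>
    by (simp add: power2_eq_square sum_product mult_ac)
  have "integrable M (\<lambda>\<omega>. (\<Sum>j<k. w j * Z j \<omega>)\<^sup>2)"
    unfolding eq using int by (intro Bochner_Integration.integrable_sum integrable_mult_right) auto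
  then show "integrable M (\<lambda>\<omega>. (\<Sum>j<k. w j * (B (real j * h + v) \<omega> - B (real j * h) \<omega>))\<^sup>2)"
    by (simp add: Z_def)
  have "(LINT \<omega>|M. (\<Sum>j<k. w j * Z j \<omega>)\<^sup>2) = (\<Sum>j<k. \<Sum>l<k. w j * w l * (LINT \<omega>|M. Z j \<omega> * Z l \<omega>))"
  proof -
    have int': "integrable M (\<lambda>\<omega>. w j * w l * (Z j \<omega> * Z l \<omega>))" if "j < k" "l < k" for j l
      using int[OF that] by simp
    have "(LINT \<omega>|M. (\<Sum>j<k. w j * Z j \<omega>)\<^sup>2) = (\<Sum>j<k. LINT \<omega>|M. (\<Sum>l<k. w j * w l * (Z j \<omega> * Z l \<omega>)))"
      unfolding eq using int' by (intro Bochner_Integration.integral_sum Bochner_Integration.integrable_sum) auto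
    also have "\<dots> = (\<Sum>j<k. \<Sum>l<k. LINT \<omega>|M. w j * w l * (Z j \<omega> * Z l \<omega>))"
      using int' by (intro sum.cong Bochner_Integration.integral_sum) auto
    finally show ?thesis by simp
  qed
  also have "\<dots> \<le> (\<Sum>j<k. \<Sum>l<k. W\<^sup>2 * c (if l \<le> j then j - l else l - j))"
  proof (intro sum_mono)
    fix j l assume jl: "j \<in> {..<k}" "l \<in> {..<k}"
    have "w j * w l * (LINT \<omega>|M. Z j \<omega> * Z l \<omega>) \<le> (\<bar>w j\<bar> * \<bar>w l\<bar>) * \<bar>LINT \<omega>|M. Z j \<omega> * Z l \<omega>\<bar>"
      by (metis abs_ge_self abs_mult)
    also have "\<dots> \<le> (W * W) * \<bar>LINT \<omega>|M. Z j \<omega> * Z l \<omega>\<bar>"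
      using jl W by (intro mult_right_mono mult_mono') auto
    finally show "w j * w l * (LINT \<omega>|M. Z j \<omega> * Z l \<omega>) \<le> W\<^sup>2 * c (if l \<le> j then j - l else l - j)"
      using jl cov[of j l] by (simp add: power2_eq_square)
  qed
  \<comment> \<open>Twice the lag sum, which is at most \<open>3 / 2 * h powr (2 * H)\<close>, gives
    the factor 3 per row.\<close>
  also have "\<dots> \<le> (\<Sum>j<k. W\<^sup>2 * (3 * h powr (2 * H)))"
  proof (intro sum_mono)
    fix j assume j: "j \<in> {..<k}"
    have "(\<Sum>l<k. c (if l \<le> j then j - l else l - j)) \<le> 2 * (\<Sum>m<k. c m)"
      using j by (intro sum_dist_le) (auto simp: c_def)
    also have "\<dots> \<le> 3 * h powr (2 * H)"
      using sum_abs_increment_cov_le[of "2 * H" v h k] H v by (simp add: c_def)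
    finally show "(\<Sum>l<k. W\<^sup>2 * c (if l \<le> j then j - l else l - j)) \<le> W\<^sup>2 * (3 * h powr (2 * H))"
      by (simp only: sum_distrib_left[symmetric]) (rule mult_left_mono, auto)
  qed
  also have "\<dots> = 3 * W\<^sup>2 * real k * h powr (2 * H)" by simp
  finally show "(LINT \<omega>|M. (\<Sum>j<k. w j * (B (real j * h + v) \<omega> - B (real j * h) \<omega>))\<^sup>2) \<le>
      3 * W\<^sup>2 * real k * h powr (2 * H)" by (simp add: Z_def)
qed

end

subsection \<open>The mean square error\<close>

text \<open>The cell index is the floor of \<open>t / h\<close>, except at \<open>t = T\<close>:
  there the floor would be \<open>n\<close>, so \<open>T\<close> is taken as the right end of the
  last cell.\<close>

lemma grid_decomposition:
  fixes T t :: real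
  assumes "0 < n" "0 < T" "t \<in> {0..T}"
  obtains k v where "k < n" "v \<in> {0..T / real n}" "t = real k * (T / real n) + v"
proof (cases "t = T")
  case True
  have "T = real (n - 1) * (T / real n) + T / real n"
    using assms by (simp add: of_nat_diff field_simps)
  then show ?thesis using that[of "n - 1" "T / real n"] assms True by auto
next
  case False
  define h where "h = T / real n"
  have h: "0 < h" "T = real n * h" using assms by (auto simp: h_def)
  define k where "k = nat \<lfloor>t / h\<rfloor>"
  have t: "0 \<le> t / h" using assms h by simp
  have k: "real k \<le> t / h" "t / h < real k + 1"
    using t by (auto simp: k_def of_nat_floor)
  have "t / h < real n" using False assms h by (simp add: pos_divide_less_eq)
  then have "k < n" using k by linarith
  moreover have "real k * h \<le> t" "t < real k * h + h"
    using k h by (auto simp: field_simps)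
  ultimately show ?thesis using that[of k "t - real k * h"] by (auto simp: h_def)
qed

text \<open>The scheme is prescribed on cells open at the left; at \<open>v = 0\<close> the formula
  is trivial, so the closed range of offsets is covered.\<close>

lemma euler_scheme_step:
  assumes "euler_scheme M T n a \<sigma> x0 B Y" "\<omega> \<in> space M" "k < n" "v \<in> {0..T / real n}"
  shows "Y (real k * (T / real n) + v) \<omega> = Y (real k * (T / real n)) \<omega> + a (Y (real k * (T / real n)) \<omega>) * v +
    \<sigma> * (B (real k * (T / real n) + v) \<omega> - B (real k * (T / real n)) \<omega>)"
proof (cases "v = 0")
  case False
  define h where "h = T / real n"
  have step: "\<forall>t\<in>{real k * h<..real (k + 1) * h}. Y t \<omega> = Y (real k * h) \<omega> +
      a (Y (real k * h) \<omega>) * (t - real k * h) + \<sigma> * (B t \<omega> - B (real k * h) \<omega>)"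
    using assms unfolding euler_scheme_def Let_def h_def by blast
  have "real k * h + v \<in> {real k * h<..real (k + 1) * h}"
    using assms(4) False by (auto simp: h_def[symmetric] distrib_right)
  from step[rule_format, OF this] show ?thesis by (simp add: h_def)
qed simp

text \<open>\<open>euler_scheme\<close> constrains \<open>Y\<close> only pointwise in the sample
  point; measurability is inherited from \<open>B\<close> through the recursion, first at grid
  points and then inside cells.\<close>

lemma euler_scheme_measurable:
  assumes Y: "euler_scheme M T n a \<sigma> x0 B Y" and T: "0 < T" and n: "0 < n"
    and B: "\<And>t. t \<in> {0..T} \<Longrightarrow> B t \<in> borel_measurable M"
    and [measurable]: "a \<in> borel_measurable borel" and t: "t \<in> {0..T}"
  shows "Y t \<in> borel_measurable M"
proof -
  define h where "h = T / real n"
  have h: "0 < h" and nh: "real n * h = T" using T n by (auto simp: h_def)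
  have kh: "real k * h \<in> {0..T}" if "k \<le> n" for k
    using mult_right_mono[of "real k" "real n" h] that h nh by simp
  have step: "Y (real k * h + v) \<in> borel_measurable M"
    if [measurable]: "Y (real k * h) \<in> borel_measurable M" and kv: "k < n" "v \<in> {0..h}" for k v
  proof -
    have "real k * h + v \<in> {0..T}"
      using kh[of "Suc k"] kh[of k] kv by (auto simp: algebra_simps)
    then have [measurable]: "B (real k * h + v) \<in> borel_measurable M" "B (real k * h) \<in> borel_measurable M"
      using B kh kv by auto
    have "(\<lambda>\<omega>. Y (real k * h) \<omega> + a (Y (real k * h) \<omega>) * v + \<sigma> * (B (real k * h + v) \<omega> - B (real k * h) \<omega>))
        \<in> borel_measurable M" by measurable
    then show ?thesis
      using euler_scheme_step[OF Y _ kv[unfolded h_def]]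
      by (subst measurable_cong) (auto simp: h_def)
  qed
  have grid: "Y (real k * h) \<in> borel_measurable M" if "k \<le> n" for k
    using that
  proof (induction k)
    case 0
    have "Y 0 \<omega> = x0" if "\<omega> \<in> space M" for \<omega>
      using Y that by (simp add: euler_scheme_def Let_def)
    then show ?case by (subst measurable_cong[where g = "\<lambda>_. x0"]) auto
  next
    case (Suc k)
    then show ?case using step[of k h] h by (simp add: algebra_simps)
  qed
  obtain k v where "k < n" "v \<in> {0..h}" "t = real k * h + v"
    using grid_decomposition[OF n T t] unfolding h_def .
  then show ?thesis using step grid by auto
qed

lemma square_of_sum3_le:
  fixes e a b c :: real
  assumes "\<bar>e\<bar> \<le> a + b + c"
  shows "e\<^sup>2 \<le> 3 * (a\<^sup>2 + b\<^sup>2 + c\<^sup>2)"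
proof -
  have "e\<^sup>2 \<le> (a + b + c)\<^sup>2"
    using assms power_mono[of "\<bar>e\<bar>" "a + b + c" 2] by simp
  also have "\<dots> = 3 * (a\<^sup>2 + b\<^sup>2 + c\<^sup>2) - ((a - b)\<^sup>2 + (b - c)\<^sup>2 + (a - c)\<^sup>2)"
    by (simp add: power2_eq_square algebra_simps)
  also have "\<dots> \<le> 3 * (a\<^sup>2 + b\<^sup>2 + c\<^sup>2)"
    using zero_le_power2[of "a - b"] zero_le_power2[of "b - c"] zero_le_power2[of "a - c"] by linarith
  finally show ?thesis .
qed

section \<open>The explicit constant and the error estimate\<close>

text \<open>The three summands are the contributions of the drift remainder, of the noise of
  complete steps and of the partial step. The factor 3 comes from squaring a sum of three terms, and
  \<open>T powr (1 - 2 * H)\<close> from trading the drift rate \<open>h\<close> for the weaker rate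
  \<open>h powr (H + 1 / 2)\<close>.\<close>

definition euler_mse_const :: "real \<Rightarrow> real \<Rightarrow> real \<Rightarrow> real \<Rightarrow> real \<Rightarrow> real" where
  "euler_mse_const H T \<sigma> x0 A =
     3 * ((2 * A\<^sup>2 * exp (2 * \<bar>A\<bar> * T) * exp (\<bar>A\<bar> * T))\<^sup>2 *
            (2 * (x0\<^sup>2 * T\<^sup>2 + \<sigma>\<^sup>2 * (T\<^sup>2 * T powr (2 * H)))) * T powr (1 - 2 * H)
       + (\<bar>A * \<sigma>\<bar> * exp (\<bar>A\<bar> * T))\<^sup>2 * (3 * (exp (\<bar>A\<bar> * T))\<^sup>2 * T)
       + \<bar>A * \<sigma>\<bar>\<^sup>2 * T)"

context fbm
begin

text \<open>The squared pathwise error has an integrable majorant \<open>Q\<close> built from three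
  random variables with known second moments; integrability and the rate both follow from
  it.\<close>

lemma euler_mean_square_error:
  assumes T: "0 < T" and n: "0 < n"
    and X: "additive_sde_solution M T (\<lambda>x. A * x) \<sigma> x0 B X"
    and Y: "euler_scheme M T n (\<lambda>x. A * x) \<sigma> x0 B Y" and t: "t \<in> {0..T}"
  shows "integrable M (\<lambda>\<omega>. (X t \<omega> - Y t \<omega>)\<^sup>2)"
    and "(LINT \<omega>|M. (X t \<omega> - Y t \<omega>)\<^sup>2) \<le> euler_mse_const H T \<sigma> x0 A * (T / real n) powr (2 * H + 1)"
proof -
  define h where "h = T / real n"
  have h: "0 < h" and nh: "real n * h = T" using T n by (auto simp: h_def)
  obtain k v where k: "k < n" and v: "v \<in> {0..h}" and tkv: "t = real k * h + v"
    using grid_decomposition[OF n T t] unfolding h_def .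
  have kh: "real k * h + h \<le> T"
    using mult_right_mono[of "real (Suc k)" "real n" h] k h nh by (simp add: algebra_simps)
  have hT: "h \<le> T" and kh0: "0 \<le> real k * h" and khT: "real k * h \<le> T"
    using kh h mult_nonneg_nonneg[of "real k" h] by linarith+
  have [measurable]: "X t \<in> borel_measurable M"
    using X t by (simp add: additive_sde_solution_def)
  have [measurable]: "Y t \<in> borel_measurable M"
    by (rule euler_scheme_measurable[OF Y T n measurable_B _ t]) auto
  define E where "E = exp (\<bar>A\<bar> * T)"
  define w where "w j = (1 + A * h) ^ (k - 1 - j)" for j
  have w: "\<bar>w j\<bar> \<le> E" if "j < k" for j
  proof -
    have "\<bar>1 + A * h\<bar> \<le> 1 + \<bar>A\<bar> * h"
      using h by (intro order_trans[OF abs_triangle_ineq]) (simp add: abs_mult)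
    also have "\<dots> \<le> exp (\<bar>A\<bar> * h)" by (rule exp_ge_add_one_self)
    finally have "\<bar>w j\<bar> \<le> exp (\<bar>A\<bar> * h) ^ (k - 1 - j)"
      unfolding w_def power_abs by (intro power_mono) auto
    also have "\<dots> = exp (\<bar>A\<bar> * (real (k - 1 - j) * h))" by (simp add: exp_of_nat_mult[symmetric] mult_ac)
    also have "\<dots> \<le> E"
      using mult_right_mono[of "real (k - 1 - j)" "real n" h] k h nh
      unfolding E_def by (intro exp_le_cancel_iff[THEN iffD2] mult_left_mono) auto
    finally show ?thesis .
  qed
  \<comment> \<open>\<open>\<beta>\<close>, \<open>G\<close> and \<open>P\<close> are measurable
    versions of the L1 norm of the noise, the propagated noise of the complete steps and the noise
    of the partial step.\<close>
  obtain \<beta> where [measurable]: "\<beta> \<in> borel_measurable M"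
    and \<beta>: "AE \<omega> in M. \<beta> \<omega> = integral {0..T} (\<lambda>u. \<bar>B u \<omega>\<bar>)"
      "integrable M (\<lambda>\<omega>. (\<beta> \<omega>)\<^sup>2)" "(LINT \<omega>|M. (\<beta> \<omega>)\<^sup>2) \<le> T\<^sup>2 * T powr (2 * H)"
  proof (rule square_moment_integral[of T "T powr (2 * H)" "\<lambda>u \<omega>. \<bar>B u \<omega>\<bar>" M])
    show "AE \<omega> in M. continuous_on {0..T} (\<lambda>u. \<bar>B u \<omega>\<bar>)"
      using continuous_paths by eventually_elim (intro continuous_intros)
  qed (use T H measurable_B integrable_square_B second_moment in \<open>auto intro: powr_mono2\<close>)
  obtain G where [measurable]: "G \<in> borel_measurable M"
    and G: "AE \<omega> in M. G \<omega> = integral {0..h} (\<lambda>u. \<Sum>j<k. w j * (B (real j * h + u) \<omega> - B (real j * h) \<omega>))"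
      "integrable M (\<lambda>\<omega>. (G \<omega>)\<^sup>2)" "(LINT \<omega>|M. (G \<omega>)\<^sup>2) \<le> h\<^sup>2 * (3 * E\<^sup>2 * real k * h powr (2 * H))"
  proof (rule square_moment_integral[of h "3 * E\<^sup>2 * real k * h powr (2 * H)"
      "\<lambda>u \<omega>. \<Sum>j<k. w j * (B (real j * h + u) \<omega> - B (real j * h) \<omega>)" M])
    have mem: "0 \<le> real j * h" "real j * h + h \<le> T" if "j < k" for j
      using that h khT mult_right_mono[of "real (Suc j)" "real k" h] by (auto simp: algebra_simps)
    show "(\<lambda>\<omega>. \<Sum>j<k. w j * (B (real j * h + u) \<omega> - B (real j * h) \<omega>)) \<in> borel_measurable M"
      if "u \<in> {0..h}" for u
    proof (intro borel_measurable_sum borel_measurable_times borel_measurable_diff measurable_B)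
      fix j assume "j \<in> {..<k}"
      then show "real j * h + u \<in> {0..T}" "real j * h \<in> {0..T}" using mem[of j] that h by auto
    qed auto
    show "AE \<omega> in M. continuous_on {0..h} (\<lambda>u. \<Sum>j<k. w j * (B (real j * h + u) \<omega> - B (real j * h) \<omega>))"
      using continuous_paths
    proof eventually_elim
      case (elim \<omega>)
      show ?case
      proof (intro continuous_on_sum continuous_intros continuous_on_compose2[OF elim])
        fix j assume "j \<in> {..<k}"
        then show "(\<lambda>u. real j * h + u) ` {0..h} \<subseteq> {0..T}" using mem[of j] by auto
      qed
    qed
  qed (use h khT w second_moment_weighted_increments[of _ h k w E] in auto)
  obtain P where [measurable]: "P \<in> borel_measurable M"
    and P: "AE \<omega> in M. P \<omega> = integral {0..v} (\<lambda>u. B (real k * h + u) \<omega> - B (real k * h) \<omega>)"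
      "integrable M (\<lambda>\<omega>. (P \<omega>)\<^sup>2)" "(LINT \<omega>|M. (P \<omega>)\<^sup>2) \<le> v\<^sup>2 * h powr (2 * H)"
  proof (rule square_moment_integral[of v "h powr (2 * H)" "\<lambda>u \<omega>. B (real k * h + u) \<omega> - B (real k * h) \<omega>" M])
    show "AE \<omega> in M. continuous_on {0..v} (\<lambda>u. B (real k * h + u) \<omega> - B (real k * h) \<omega>)"
      using continuous_paths
    proof eventually_elim
      case (elim \<omega>)
      show ?case
        using kh kh0 v by (intro continuous_intros continuous_on_compose2[OF elim]) auto
    qed
    fix u assume "u \<in> {0..v}"
    then have u: "0 \<le> real k * h" "0 \<le> u" "real k * h + u \<le> T" "u \<le> h" using v kh kh0 by auto
    then show "(\<lambda>\<omega>. B (real k * h + u) \<omega> - B (real k * h) \<omega>) \<in> borel_measurable M"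
      by (intro borel_measurable_diff measurable_B) auto
    show "integrable M (\<lambda>\<omega>. (B (real k * h + u) \<omega> - B (real k * h) \<omega>)\<^sup>2)"
      using second_moment_increment(1)[OF u(1-3)] .
    show "(LINT \<omega>|M. (B (real k * h + u) \<omega> - B (real k * h) \<omega>)\<^sup>2) \<le> h powr (2 * H)"
      using second_moment_increment(2)[OF u(1-3)] u H by (simp add: powr_mono2)
  qed (use v in auto)
  define c where "c = 2 * A\<^sup>2 * exp (2 * \<bar>A\<bar> * T) * E"
  define d where "d = \<bar>A * \<sigma>\<bar>"
  \<comment> \<open>The inner factor 2 comes from bounding the square of
    \<open>\<bar>x0\<bar> * T + \<bar>\<sigma>\<bar> * \<beta> \<omega>\<close> by twice the sum of
    the squares.\<close>
  define Q where "Q \<omega> = 3 * (c\<^sup>2 * h\<^sup>2 * (2 * (x0\<^sup>2 * T\<^sup>2 + \<sigma>\<^sup>2 * (\<beta> \<omega>)\<^sup>2)) + (d * E)\<^sup>2 * (G \<omega>)\<^sup>2 + d\<^sup>2 * (P \<omega>)\<^sup>2)" for \<omega>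
  have Qint: "integrable M Q"
    unfolding Q_def using \<beta>(2) G(2) P(2) by simp
  have bound: "AE \<omega> in M. (X t \<omega> - Y t \<omega>)\<^sup>2 \<le> Q \<omega>"
  proof -
    have "AE \<omega> in M. continuous_on {0..T} (\<lambda>t. X t \<omega>) \<and>
        (\<forall>t\<in>{0..T}. X t \<omega> = x0 + integral {0..t} (\<lambda>s. A * X s \<omega>) + \<sigma> * B t \<omega>)"
      using X by (simp add: additive_sde_solution_def)
    then show ?thesis
      using continuous_paths B_0 \<beta>(1) G(1) P(1) AE_space
    proof eventually_elim
      case (elim \<omega>)
      have eq: "X t \<omega> = x0 + integral {0..t} (\<lambda>s. A * X s \<omega>) + \<sigma> * B t \<omega>" if "t \<in> {0..T}" for t
        using elim(1) that by blast
      have y0: "Y 0 \<omega> = x0"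
        using Y elim(7) by (simp add: euler_scheme_def Let_def)
      have 1: "\<bar>X t \<omega> - Y t \<omega>\<bar> \<le> 2 * A\<^sup>2 * exp (2 * \<bar>A\<bar> * T) * (h * integral {0..T} (\<lambda>s. \<bar>X s \<omega>\<bar>))
          + d * E * \<bar>G \<omega>\<bar> + d * \<bar>P \<omega>\<bar>"
        unfolding tkv d_def E_def elim(5,6) w_def
        unfolding h_def
        by (rule linear_euler_path_bound[OF T n conjunct1[OF elim(1)] elim(2) elim(3) eq y0
            euler_scheme_step[OF Y elim(7)] k v[unfolded h_def]])
      have "integral {0..T} (\<lambda>s. \<bar>X s \<omega>\<bar>) \<le> E * (\<bar>x0\<bar> * T + \<bar>\<sigma>\<bar> * \<beta> \<omega>)"
        unfolding E_def elim(4)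
        using linear_sde_L1_bound[OF _ conjunct1[OF elim(1)] elim(2) eq] T by simp
      then have "2 * A\<^sup>2 * exp (2 * \<bar>A\<bar> * T) * (h * integral {0..T} (\<lambda>s. \<bar>X s \<omega>\<bar>)) \<le>
          2 * A\<^sup>2 * exp (2 * \<bar>A\<bar> * T) * (h * (E * (\<bar>x0\<bar> * T + \<bar>\<sigma>\<bar> * \<beta> \<omega>)))"
        using h by (intro mult_left_mono) auto
      also have "\<dots> = c * h * (\<bar>x0\<bar> * T + \<bar>\<sigma>\<bar> * \<beta> \<omega>)"
        by (simp add: c_def)
      finally have "\<bar>X t \<omega> - Y t \<omega>\<bar> \<le> c * h * (\<bar>x0\<bar> * T + \<bar>\<sigma>\<bar> * \<beta> \<omega>) + d * E * \<bar>G \<omega>\<bar> + d * \<bar>P \<omega>\<bar>"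
        using 1 by linarith
      then have "(X t \<omega> - Y t \<omega>)\<^sup>2 \<le> 3 * ((c * h * (\<bar>x0\<bar> * T + \<bar>\<sigma>\<bar> * \<beta> \<omega>))\<^sup>2 + (d * E * \<bar>G \<omega>\<bar>)\<^sup>2 + (d * \<bar>P \<omega>\<bar>)\<^sup>2)"
        by (rule square_of_sum3_le)
      also have "\<dots> = 3 * (c\<^sup>2 * h\<^sup>2 * (\<bar>x0\<bar> * T + \<bar>\<sigma>\<bar> * \<beta> \<omega>)\<^sup>2 + (d * E)\<^sup>2 * (G \<omega>)\<^sup>2 + d\<^sup>2 * (P \<omega>)\<^sup>2)"
        by (simp add: power_mult_distrib)
      also have "(\<bar>x0\<bar> * T + \<bar>\<sigma>\<bar> * \<beta> \<omega>)\<^sup>2 \<le> 2 * (x0\<^sup>2 * T\<^sup>2 + \<sigma>\<^sup>2 * (\<beta> \<omega>)\<^sup>2)"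
        using sum_squares_bound[of "\<bar>x0\<bar> * T" "\<bar>\<sigma>\<bar> * \<beta> \<omega>"] by (simp add: power2_sum power_mult_distrib mult_ac)
      finally show ?case by (simp add: Q_def mult_left_mono)
    qed
  qed
  show int: "integrable M (\<lambda>\<omega>. (X t \<omega> - Y t \<omega>)\<^sup>2)"
    by (rule Bochner_Integration.integrable_bound[OF Qint]) (use bound in auto)
  have "(LINT \<omega>|M. (X t \<omega> - Y t \<omega>)\<^sup>2) \<le> (LINT \<omega>|M. Q \<omega>)"
    using int Qint bound by (rule integral_mono_AE)
  also have "\<dots> = 3 * (c\<^sup>2 * h\<^sup>2 * (2 * (x0\<^sup>2 * T\<^sup>2 + \<sigma>\<^sup>2 * (LINT \<omega>|M. (\<beta> \<omega>)\<^sup>2))) +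
      (d * E)\<^sup>2 * (LINT \<omega>|M. (G \<omega>)\<^sup>2) + d\<^sup>2 * (LINT \<omega>|M. (P \<omega>)\<^sup>2))"
    unfolding Q_def using \<beta>(2) G(2) P(2) by (simp add: prob_space)
  also have "\<dots> \<le> 3 * (c\<^sup>2 * (h powr (2 * H + 1) * T powr (1 - 2 * H)) * (2 * (x0\<^sup>2 * T\<^sup>2 + \<sigma>\<^sup>2 * (T\<^sup>2 * T powr (2 * H)))) +
      (d * E)\<^sup>2 * (3 * E\<^sup>2 * T * h powr (2 * H + 1)) + d\<^sup>2 * (T * h powr (2 * H + 1)))"
  proof -
    have hp: "h powr (2 * H + 1) = h * h powr (2 * H)"
      using h by (simp add: powr_add)
    \<comment> \<open>The drift contributes order \<open>h\<close> to the error; as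
      \<open>1 - 2 * H\<close> is nonnegative and \<open>h \<le> T\<close>, its square is of order
      \<open>h powr (2 * H + 1)\<close>.\<close>
    have "h\<^sup>2 = h powr (2 * H + 1) * h powr (1 - 2 * H)"
      using h by (simp flip: powr_add)
    also have "\<dots> \<le> h powr (2 * H + 1) * T powr (1 - 2 * H)"
      using h hT H by (intro mult_left_mono powr_mono2) auto
    finally have a: "h\<^sup>2 \<le> h powr (2 * H + 1) * T powr (1 - 2 * H)" .
    \<comment> \<open>One factor \<open>h\<close> pairs with the number of steps to give
      \<open>real k * h \<le> T\<close>; the other raises the exponent to
      \<open>2 * H + 1\<close>.\<close>
    have "h\<^sup>2 * (3 * E\<^sup>2 * real k * h powr (2 * H)) = 3 * E\<^sup>2 * (real k * h) * h powr (2 * H + 1)"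
      by (simp add: hp power2_eq_square)
    also have "\<dots> \<le> 3 * E\<^sup>2 * T * h powr (2 * H + 1)"
      using khT by (intro mult_right_mono mult_left_mono) auto
    finally have b: "(LINT \<omega>|M. (G \<omega>)\<^sup>2) \<le> 3 * E\<^sup>2 * T * h powr (2 * H + 1)"
      using G(3) by simp
    have "v\<^sup>2 * h powr (2 * H) \<le> T * h * h powr (2 * H)"
      unfolding power2_eq_square using v hT by (intro mult_right_mono mult_mono) auto
    then have p: "(LINT \<omega>|M. (P \<omega>)\<^sup>2) \<le> T * h powr (2 * H + 1)"
      using P(3) by (simp add: hp)
    show ?thesis
      by (intro mult_left_mono mult_mono add_mono order_refl a b p \<beta>(3))
        (auto intro!: mult_nonneg_nonneg add_nonneg_nonneg)
  qed
  also have "\<dots> = euler_mse_const H T \<sigma> x0 A * h powr (2 * H + 1)"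
    by (simp add: euler_mse_const_def c_def d_def E_def algebra_simps)
  finally show "(LINT \<omega>|M. (X t \<omega> - Y t \<omega>)\<^sup>2) \<le> euler_mse_const H T \<sigma> x0 A * (T / real n) powr (2 * H + 1)"
    by (simp add: h_def)
qed

end

text \<open>\<open>C\<close> is quantified before the probability space, the processes and
  \<open>n\<close>, so it is uniform in all of them. Integrability and \<open>bdd_above\<close> are
  asserted as well because the integral of a non-integrable function is 0 by default and the
  supremum of an unbounded real set is unspecified.\<close>

theorem corollary3p3:
  fixes H T \<sigma> X\<^sub>0 A :: real and a :: "real \<Rightarrow> real"
  assumes "1 / 3 < H" and "H < 1 / 2" and "T > 0"
    and "\<And>x. a x = A * x"
  shows "\<exists>C. \<forall>(M :: 'w measure) B X.
    prob_space M \<and> fractional_brownian_motion M H T B \<and> additive_sde_solution M T a \<sigma> X\<^sub>0 B X \<longrightarrow>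
    (\<forall>n\<ge>1. \<forall>Y. euler_scheme M T n a \<sigma> X\<^sub>0 B Y \<longrightarrow>
      (\<forall>t\<in>{0..T}. integrable M (\<lambda>\<omega>. \<bar>X t \<omega> - Y t \<omega>\<bar>\<^sup>2)) \<and>
      bdd_above ((\<lambda>t. LINT \<omega>|M. \<bar>X t \<omega> - Y t \<omega>\<bar>\<^sup>2) ` {0..T}) \<and>
      sqrt (SUP t\<in>{0..T}. LINT \<omega>|M. \<bar>X t \<omega> - Y t \<omega>\<bar>\<^sup>2) \<le> C * (T / real n) powr (H + 1 / 2))"
proof (intro exI allI impI, elim conjE)
  have a: "a = (\<lambda>x. A * x)" using assms(4) by auto
  fix M :: "'w measure" and B X :: "real \<Rightarrow> 'w \<Rightarrow> real" and n :: nat and Y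
  assume M: "prob_space M" and B: "fractional_brownian_motion M H T B"
    and X: "additive_sde_solution M T a \<sigma> X\<^sub>0 B X"
    and n: "1 \<le> n" and Y: "euler_scheme M T n a \<sigma> X\<^sub>0 B Y"
  interpret fbm M H T B
    using M B assms by (intro fbm.intro fbm_axioms.intro) auto
  \<comment> \<open>The witness is \<open>sqrt ?K\<close>; \<open>?K\<close> depends only on the
    fixed parameters.\<close>
  let ?K = "euler_mse_const H T \<sigma> X\<^sub>0 A"
  let ?h = "T / real n"
  have h: "0 < ?h" using n assms(3) by simp
  note mse = euler_mean_square_error[OF assms(3) _ X[unfolded a] Y[unfolded a]]
  have le: "(LINT \<omega>|M. \<bar>X t \<omega> - Y t \<omega>\<bar>\<^sup>2) \<le> ?K * ?h powr (2 * H + 1)" if "t \<in> {0..T}" for t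
    using mse(2)[OF _ that] n by simp
  have "(SUP t\<in>{0..T}. LINT \<omega>|M. \<bar>X t \<omega> - Y t \<omega>\<bar>\<^sup>2) \<le> ?K * ?h powr (2 * H + 1)"
    using assms(3) le by (intro cSUP_least) auto
  then have "sqrt (SUP t\<in>{0..T}. LINT \<omega>|M. \<bar>X t \<omega> - Y t \<omega>\<bar>\<^sup>2) \<le> sqrt (?K * ?h powr (2 * H + 1))"
    by (rule real_sqrt_le_mono)
  also have "?h powr (2 * H + 1) = (?h powr (H + 1 / 2))\<^sup>2"
    using h by (simp add: power2_eq_square powr_add[symmetric])
  also have "sqrt (?K * (?h powr (H + 1 / 2))\<^sup>2) = sqrt ?K * ?h powr (H + 1 / 2)"
    by (simp add: real_sqrt_mult)
  finally have "sqrt (SUP t\<in>{0..T}. LINT \<omega>|M. \<bar>X t \<omega> - Y t \<omega>\<bar>\<^sup>2) \<le> sqrt ?K * ?h powr (H + 1 / 2)" .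
  moreover have "bdd_above ((\<lambda>t. LINT \<omega>|M. \<bar>X t \<omega> - Y t \<omega>\<bar>\<^sup>2) ` {0..T})"
    using le by (intro bdd_aboveI2)
  moreover have "\<forall>t\<in>{0..T}. integrable M (\<lambda>\<omega>. \<bar>X t \<omega> - Y t \<omega>\<bar>\<^sup>2)"
    using mse(1) n by simp
  ultimately show "(\<forall>t\<in>{0..T}. integrable M (\<lambda>\<omega>. \<bar>X t \<omega> - Y t \<omega>\<bar>\<^sup>2)) \<and>
      bdd_above ((\<lambda>t. LINT \<omega>|M. \<bar>X t \<omega> - Y t \<omega>\<bar>\<^sup>2) ` {0..T}) \<and>
      sqrt (SUP t\<in>{0..T}. LINT \<omega>|M. \<bar>X t \<omega> - Y t \<omega>\<bar>\<^sup>2) \<le> sqrt ?K * ?h powr (H + 1 / 2)"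
    by blast
qed

end
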